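(* Let $S$ be a finite ai-semiring. Every subgroup of the multiplicative reduct $(S,\cdot)$ is an antichain in the additive order of $S$.
   Context: An ai-semiring is an algebra $(S,+,\cdot)$ such that $(S,+)$ is a commutative idempotent semigroup, $(S,\cdot)$ is a semigroup, and $\cdot$ distributes over $+$ on both sides. Its additive order is $a\le b\iff a+b=b$. A subgroup of a semigroup is a subsemigroup that is a group under the induced multiplication (its identity may be any idempotent of the semigroup). *)

theory Defs
  imports "HOL-Algebra.Group"
begin

text \<open>Neither an additive nor a multiplicative neutral element is required.\<close>

locale ai_semiring =
  fixes S :: "'a set"
    and add :: "'a \<Rightarrow> 'a \<Rightarrow> 'a"  (infixl "\<^bold>+" 65)
    and mul :: "'a \<Rightarrow> 'a \<Rightarrow> 'a"  (infixl "\<^bold>*" 70)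
  assumes add_closed: "\<lbrakk>a \<in> S; b \<in> S\<rbrakk> \<Longrightarrow> a \<^bold>+ b \<in> S"
    and add_assoc: "\<lbrakk>a \<in> S; b \<in> S; c \<in> S\<rbrakk> \<Longrightarrow> (a \<^bold>+ b) \<^bold>+ c = a \<^bold>+ (b \<^bold>+ c)"
    and add_commute: "\<lbrakk>a \<in> S; b \<in> S\<rbrakk> \<Longrightarrow> a \<^bold>+ b = b \<^bold>+ a"
    and add_idem: "a \<in> S \<Longrightarrow> a \<^bold>+ a = a"
    and mul_closed: "\<lbrakk>a \<in> S; b \<in> S\<rbrakk> \<Longrightarrow> a \<^bold>* b \<in> S"
    and mul_assoc: "\<lbrakk>a \<in> S; b \<in> S; c \<in> S\<rbrakk> \<Longrightarrow> (a \<^bold>* b) \<^bold>* c = a \<^bold>* (b \<^bold>* c)"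
    and distrib_left: "\<lbrakk>a \<in> S; b \<in> S; c \<in> S\<rbrakk> \<Longrightarrow> a \<^bold>* (b \<^bold>+ c) = a \<^bold>* b \<^bold>+ a \<^bold>* c"
    and distrib_right: "\<lbrakk>a \<in> S; b \<in> S; c \<in> S\<rbrakk> \<Longrightarrow> (a \<^bold>+ b) \<^bold>* c = a \<^bold>* c \<^bold>+ b \<^bold>* c"

definition additive_le :: "('a \<Rightarrow> 'a \<Rightarrow> 'a) \<Rightarrow> 'a \<Rightarrow> 'a \<Rightarrow> bool" where
  "additive_le add a b \<longleftrightarrow> add a b = b"

text \<open>The identity \<open>e\<close> is not prescribed, so the library's \<^const>\<open>subgroup\<close>, which uses the
  identity of the ambient structure, does not apply. Closure under \<open>mul\<close> is part of
  \<^const>\<open>group\<close>, whose carrier here is \<open>H\<close>.\<close>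

definition semigroup_subgroup :: "'a set \<Rightarrow> ('a \<Rightarrow> 'a \<Rightarrow> 'a) \<Rightarrow> 'a set \<Rightarrow> bool" where
  "semigroup_subgroup S mul H \<longleftrightarrow>
     H \<subseteq> S \<and> (\<exists>e. group \<lparr>carrier = H, monoid.mult = mul, one = e\<rparr>)"

definition antichain :: "('a \<Rightarrow> 'a \<Rightarrow> bool) \<Rightarrow> 'a set \<Rightarrow> bool" where
  "antichain leq A \<longleftrightarrow> (\<forall>a\<in>A. \<forall>b\<in>A. a \<noteq> b \<longrightarrow> \<not> leq a b)"

end

theory Submission
  imports Defs "HOL-Algebra.Multiplicative_Group"
begin

text \<open>If \<open>a \<le> b\<close> in a subgroup with identity \<open>e\<close>, then \<open>c = a\<inverse> b\<close> satisfies \<open>e \<le> c\<close>. Multiplication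
  is monotone, so \<open>e \<le> c \<le> c\<^sup>2 \<le> \<dots>\<close>, and this chain returns to \<open>e\<close> because \<open>c\<close> has finite order.
  Hence \<open>c = e\<close>.\<close>

context ai_semiring
begin

lemma additive_le_trans:
  assumes "a \<in> S" "b \<in> S" "c \<in> S" "additive_le add a b" "additive_le add b c"
  shows "additive_le add a c"
  using assms add_assoc[of a b c] by (simp add: additive_le_def)

lemma additive_le_antisym:
  assumes "a \<in> S" "b \<in> S" "additive_le add a b" "additive_le add b a"
  shows "a = b"
  using assms add_commute[of a b] by (simp add: additive_le_def)

lemma mul_left_mono:
  assumes "a \<in> S" "b \<in> S" "c \<in> S" "additive_le add a b"
  shows "additive_le add (c \<^bold>* a) (c \<^bold>* b)"
  using assms distrib_left[of c a b] by (simp add: additive_le_def)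

lemma mul_right_mono:
  assumes "a \<in> S" "b \<in> S" "c \<in> S" "additive_le add a b"
  shows "additive_le add (a \<^bold>* c) (b \<^bold>* c)"
  using assms distrib_right[of a b c] by (simp add: additive_le_def)

text \<open>Taking the subgroup as a record \<open>G\<close> with multiplication \<open>mul\<close>
  makes the library facts on inverses, powers and order available; its identity can be any
  idempotent of \<open>S\<close>.\<close>

lemma finite_group_additive_le_imp_eq:
  assumes G: "group G" and mult: "monoid.mult G = mul"
    and sub: "carrier G \<subseteq> S" and fin: "finite (carrier G)"
    and a: "a \<in> carrier G" and b: "b \<in> carrier G" and le: "additive_le add a b"
  shows "a = b"
proof -
  interpret G: group G by (fact G)
  define c where "c = inv\<^bsub>G\<^esub> a \<otimes>\<^bsub>G\<^esub> b"
  have c: "c \<in> carrier G" using a b by (simp add: c_def)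
  have "additive_le add (inv\<^bsub>G\<^esub> a \<otimes>\<^bsub>G\<^esub> a) c"
    unfolding c_def mult using a b sub le by (intro mul_left_mono) auto
  then have one_le: "additive_le add \<one>\<^bsub>G\<^esub> c" using a by simp
  have S: "x \<in> S" if "x \<in> carrier G" for x using that sub by blast
  \<comment> \<open>Right multiplication by \<open>c\<close> turns the pair \<open>\<one>\<close>,
    \<open>c [^] k\<close> into \<open>c\<close>, \<open>c [^] Suc k\<close>. The lower bound
    \<open>c\<close>, stronger than \<open>\<one>\<close>, is what closes the cycle below.\<close>
  have step: "additive_le add c (c [^]\<^bsub>G\<^esub> Suc k)" if "additive_le add \<one>\<^bsub>G\<^esub> (c [^]\<^bsub>G\<^esub> k)" for k :: nat
    using mul_right_mono[OF _ _ _ that, of c] c S by (simp flip: mult)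
  have pow: "additive_le add \<one>\<^bsub>G\<^esub> (c [^]\<^bsub>G\<^esub> k)" for k :: nat
  proof (induction k)
    case 0
    show ?case using S add_idem by (simp add: additive_le_def)
  next
    case (Suc k)
    show ?case
      using additive_le_trans[OF _ _ _ one_le step[OF Suc]] c S G.nat_pow_closed by blast
  qed
  \<comment> \<open>Positivity lets the order be written as a successor, so \<open>step\<close>
    applies with \<open>k = order G - 1\<close> and yields \<open>c \<le> \<one>\<close>.\<close>
  have "order G > 0" using fin G.order_gt_0_iff_finite by blast
  then have "c [^]\<^bsub>G\<^esub> Suc (order G - 1) = \<one>\<^bsub>G\<^esub>" using G.pow_order_eq_1[OF c] by simp
  then have "additive_le add c \<one>\<^bsub>G\<^esub>" using step[OF pow] by metis
  then have "c = \<one>\<^bsub>G\<^esub>" using additive_le_antisym one_le c S by blast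
  \<comment> \<open>By the definition of \<open>c\<close>, the same product also equals
    \<open>b\<close>.\<close>
  then have "a \<otimes>\<^bsub>G\<^esub> c = a" using a by simp
  then show "a = b" using a b by (simp add: c_def flip: G.m_assoc)
qed

end

theorem proposition2p19:
  fixes S H :: "'a set"
    and add mul :: "'a \<Rightarrow> 'a \<Rightarrow> 'a"
  assumes "ai_semiring S add mul"
    and "finite S"
    and "semigroup_subgroup S mul H"
  shows "antichain (additive_le add) H"
proof -
  interpret ai_semiring S add mul by (fact assms(1))
  obtain e where sub: "H \<subseteq> S" and G: "group \<lparr>carrier = H, monoid.mult = mul, one = e\<rparr>"
    using assms(3) by (auto simp: semigroup_subgroup_def)
  then have "finite H" using assms(2) finite_subset by blast
  then show ?thesis
    unfolding antichain_def using finite_group_additive_le_imp_eq[OF G] sub by auto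
qed

end
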